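(* For every integer $n\ge 0$, the map $\psi$ (defined in the context) is a bijection between the set $\mathcal{SH}_n$ of UH-free Schröder paths of semilength $n$ and the set $\mathcal{SE}_n$ of Schröder paths of semilength $n$ without peaks at even level.
   Context: A Schröder path of semilength $n$ is a lattice path from $(0,0)$ to $(2n,0)$ that never goes below the $x$-axis and consists of up steps $U=(1,1)$, down steps $D=(1,-1)$ and horizontal steps $H=(2,0)$. It is UH-free if no up step is immediately followed by a horizontal step. A peak is an up step immediately followed by a down step; its level is the larger $y$-coordinate of its up step. $\mathcal{SH}_n$ is the set of UH-free Schröder paths of semilength $n$, and $\mathcal{SE}_n$ is the set of Schröder paths of semilength $n$ having no peak at an even level. Definition of $\psi$ (recursive). For a UH-free Schröder path $P$: if $P$ is empty, $\psi(P)$ is empty. Otherwise: (1) if $P=HP'$ with $P'$ a possibly empty UH-free Schröder path, then $\psi(P)=H\psi(P')$; (2) if $P=UDP'$ with $P'$ a possibly empty UH-free Schröder path, then $\psi(P)=UD\psi(P')$; (3) if $P=U^kDP_1DP_2\cdots DP_k$ with $k\ge 2$, where $U^k$ denotes $k$ consecutive up steps and each $P_i$ is a possibly empty UH-free Schröder path (up to translation), then $\psi(P)=UP_1'P_2'\cdots P_{k-1}'D\psi(P_k)$, where for $1\le i\le k-1$, $P_i'=H$ if $P_i$ is empty and $P_i'=U\psi(P_i)D$ otherwise. *)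

theory Defs
  imports Main "HOL-Library.Sublist" "HOL-Library.Product_Plus"
begin

datatype step = U | D | H

type_synonym path = "step list"

fun step_vector :: "step \<Rightarrow> int \<times> int" where
  "step_vector U = (1, 1)"
| "step_vector D = (1, - 1)"
| "step_vector H = (2, 0)"

text \<open>Paths start at the origin.\<close>

definition endpoint :: "path \<Rightarrow> int \<times> int" where
  "endpoint P = sum_list (map step_vector P)"

text \<open>Every point of a path with minimal height can be taken to be a vertex, so staying weakly
  above the axis is a condition on the endpoints of the prefixes.\<close>

definition schroeder_path :: "nat \<Rightarrow> path \<Rightarrow> bool" where
  "schroeder_path n P \<longleftrightarrow>
     endpoint P = (2 * int n, 0) \<and> (\<forall>Q. prefix Q P \<longrightarrow> snd (endpoint Q) \<ge> 0)"

text \<open>Here \<open>sublist\<close> is the contiguous notion.\<close>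

definition UH_free :: "path \<Rightarrow> bool" where
  "UH_free P \<longleftrightarrow> \<not> sublist [U, H] P"

definition peak_level :: "path \<Rightarrow> int \<Rightarrow> bool" where
  "peak_level P l \<longleftrightarrow> (\<exists>A B. P = A @ [U, D] @ B \<and> l = snd (endpoint (A @ [U])))"

definition SH :: "nat \<Rightarrow> path set" where
  "SH n = {P. schroeder_path n P \<and> UH_free P}"

definition SE :: "nat \<Rightarrow> path set" where
  "SE n = {P. schroeder_path n P \<and> \<not> (\<exists>l. peak_level P l \<and> even l)}"

definition UH_free_schroeder :: "path \<Rightarrow> bool" where
  "UH_free_schroeder P \<longleftrightarrow> (\<exists>n. P \<in> SH n)"

subsection \<open>Existence and uniqueness of the decomposition\<close>

lemma endpoint_simps [simp]:
  "endpoint [] = (0, 0)"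
  "endpoint (s # P) = step_vector s + endpoint P"
  "endpoint (P @ Q) = endpoint P + endpoint Q"
  by (simp_all add: endpoint_def zero_prod_def)

lemma endpoint_parity: "fst (endpoint P) \<ge> 0 \<and> even (fst (endpoint P) - snd (endpoint P))"
proof (induction P)
  case (Cons s P)
  then show ?case by (cases s) auto
qed simp

lemma ex_schroeder_path_iff:
  "(\<exists>n. schroeder_path n P) \<longleftrightarrow>
     snd (endpoint P) = 0 \<and> (\<forall>Q. prefix Q P \<longrightarrow> snd (endpoint Q) \<ge> 0)"
proof
  assume R: "snd (endpoint P) = 0 \<and> (\<forall>Q. prefix Q P \<longrightarrow> snd (endpoint Q) \<ge> 0)"
  then have "even (fst (endpoint P))" "fst (endpoint P) \<ge> 0"
    using endpoint_parity[of P] by auto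
  then obtain m where m: "fst (endpoint P) = 2 * m" "m \<ge> 0" by auto
  then have "endpoint P = (2 * int (nat m), 0)"
    using R by (simp add: prod_eq_iff)
  then show "\<exists>n. schroeder_path n P" using R unfolding schroeder_path_def by blast
qed (auto simp: schroeder_path_def)

lemma UH_free_schroeder_iff:
  "UH_free_schroeder P \<longleftrightarrow> UH_free P \<and> snd (endpoint P) = 0 \<and>
     (\<forall>Q. prefix Q P \<longrightarrow> snd (endpoint Q) \<ge> 0)"
  unfolding UH_free_schroeder_def SH_def using ex_schroeder_path_iff[of P] by auto

lemma UH_free_schroeder_Nil [simp]: "UH_free_schroeder []"
  by (simp add: UH_free_schroeder_iff UH_free_def)

lemma UH_free_sublist: "UH_free P \<Longrightarrow> sublist Q P \<Longrightarrow> UH_free Q"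
  unfolding UH_free_def using sublist_order.order_trans by blast

lemma descent_decomposition:
  assumes "\<And>Q. prefix Q R \<Longrightarrow> int m + snd (endpoint Q) \<ge> 0"
    and "int m + snd (endpoint R) = 0"
  shows "\<exists>P Ps. R = P @ concat (map ((#) D) Ps) \<and> length Ps = m \<and>
    (\<forall>X \<in> insert P (set Ps). snd (endpoint X) = 0 \<and>
       (\<forall>Q. prefix Q X \<longrightarrow> snd (endpoint Q) \<ge> 0))"
  using assms
proof (induction R arbitrary: m)
  case Nil
  then show ?case by (intro exI[of _ "[]"]) auto
next
  case (Cons s R)
  have pre: "int m + snd (step_vector s) + snd (endpoint Q) \<ge> 0" if "prefix Q R" for Q
    using Cons.prems(1)[of "s # Q"] that by simp
  have tot: "int m + snd (step_vector s) + snd (endpoint R) = 0"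
    using Cons.prems(2) by simp
  show ?case
  proof (cases s)
    case H
    obtain P Ps where *: "R = P @ concat (map ((#) D) Ps)" "length Ps = m"
      "\<forall>X \<in> insert P (set Ps). snd (endpoint X) = 0 \<and>
        (\<forall>Q. prefix Q X \<longrightarrow> snd (endpoint Q) \<ge> 0)"
      using Cons.IH[of m] pre tot H by auto
    show ?thesis
      by (rule exI[of _ "H # P"], rule exI[of _ Ps])
        (use * H in \<open>auto simp: prefix_Cons\<close>)
  next
    case U
    obtain P Ps where *: "R = P @ concat (map ((#) D) Ps)" "length Ps = Suc m"
      "\<forall>X \<in> insert P (set Ps). snd (endpoint X) = 0 \<and>
        (\<forall>Q. prefix Q X \<longrightarrow> snd (endpoint Q) \<ge> 0)"
      using Cons.IH[of "Suc m"] pre tot U by (auto simp: add_ac)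
    then obtain P2 Ps2 where Ps: "Ps = P2 # Ps2" by (cases Ps) auto
    have "0 \<le> snd (endpoint Q)" if "prefix Q (U # P @ D # P2)" for Q
    proof (cases Q)
      case Nil
      then show ?thesis by simp
    next
      case (Cons q Q')
      then have Q': "q = U" "prefix Q' (P @ D # P2)" using that by auto
      from Q'(2) consider "prefix Q' P" | Z where "Q' = P @ Z" "prefix Z (D # P2)"
        by (auto simp: prefix_append)
      then show ?thesis
      proof cases
        case 1
        then have "0 \<le> snd (endpoint Q')" using * by blast
        then show ?thesis using Cons Q' by simp
      next
        case 2
        then have "snd (endpoint Z) \<ge> - 1"
          using * Ps by (auto simp: prefix_Cons)
        then show ?thesis using Cons Q' 2 * by simp
      qed
    qed
    then show ?thesis
      by (intro exI[of _ "U # P @ D # P2"] exI[of _ Ps2]) (use * Ps U in auto)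
  next
    case D
    have "m \<ge> 1" using Cons.prems(1)[of "[D]"] D by auto
    then obtain m' where m': "m = Suc m'" by (cases m) auto
    obtain P Ps where *: "R = P @ concat (map ((#) D) Ps)" "length Ps = m'"
      "\<forall>X \<in> insert P (set Ps). snd (endpoint X) = 0 \<and>
        (\<forall>Q. prefix Q X \<longrightarrow> snd (endpoint Q) \<ge> 0)"
      using Cons.IH[of m'] pre tot D m' by auto
    show ?thesis
      by (rule exI[of _ "[]"], rule exI[of _ "P # Ps"]) (use * D m' in auto)
  qed
qed

lemma prefix_height:
  "UH_free_schroeder P \<Longrightarrow> prefix Q P \<Longrightarrow> snd (endpoint Q) \<ge> 0"
  by (simp add: UH_free_schroeder_iff)

lemma UH_free_schroeder_cases:
  assumes "UH_free_schroeder P"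
  obtains (Nil) "P = []"
  | (H) P' where "P = H # P'" "UH_free_schroeder P'"
  | (UD) P' where "P = U # D # P'" "UH_free_schroeder P'"
  | (UU) k Ps where "P = replicate k U @ concat (map ((#) D) Ps)" "k \<ge> 2" "length Ps = k"
      "\<forall>Q \<in> set Ps. UH_free_schroeder Q"
proof (cases "P = [] \<or> hd P = H")
  case True
  show ?thesis
  proof (cases P)
    case (Cons s P')
    then have s: "P = H # P'" using True by simp
    have "snd (endpoint Q) \<ge> 0" if "prefix Q P'" for Q
      using prefix_height[OF assms, of "H # Q"] s that by simp
    moreover have "UH_free P'"
      using assms s by (simp add: UH_free_schroeder_iff UH_free_def sublist_Cons_right)
    ultimately have "UH_free_schroeder P'"
      using assms s by (auto simp: UH_free_schroeder_iff)
    then show ?thesis by (rule H[OF s])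
  qed (rule Nil)
next
  case False
  define k where "k = length (takeWhile ((=) U) P)"
  define R where "R = dropWhile ((=) U) P"
  have tw: "takeWhile ((=) U) P = replicate k U"
    unfolding k_def by (rule replicate_length_same[symmetric]) (auto dest: set_takeWhileD)
  have P: "P = replicate k U @ R"
    unfolding R_def using takeWhile_dropWhile_id[of "(=) U" P] tw by simp
  have ht: "endpoint (replicate j U) = (int j, int j)" for j
    by (induction j) (auto simp: zero_prod_def)
  have "hd P \<noteq> D"
  proof
    assume "hd P = D"
    then have "prefix [D] P" using False by (cases P) auto
    then show False using prefix_height[OF assms, of "[D]"] by simp
  qed
  then have "hd P = U" using False by (cases "hd P") auto
  then have k: "k \<ge> 1" unfolding k_def using False by (cases P) auto
  have "R \<noteq> []"
    using assms P k by (auto simp: UH_free_schroeder_iff ht)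
  then obtain r R' where r: "R = r # R'" by (cases R) auto
  have "r \<noteq> U" using hd_dropWhile[of "(=) U" P] \<open>R \<noteq> []\<close> r unfolding R_def by auto
  moreover have "r \<noteq> H"
  proof
    assume "r = H"
    moreover obtain j where "k = Suc j" using k by (cases k) auto
    ultimately have "P = replicate j U @ [U, H] @ R'"
      using P r by (simp add: replicate_app_Cons_same)
    then have "sublist [U, H] P" by blast
    then show False using assms by (simp add: UH_free_schroeder_iff UH_free_def)
  qed
  ultimately have rD: "r = D" by (cases r) auto
  have pre: "int k + snd (endpoint Q) \<ge> 0" if "prefix Q R" for Q
    using prefix_height[OF assms, of "replicate k U @ Q"] P that by (simp add: ht)
  have pre': "int (k - 1) + snd (endpoint Q) \<ge> 0" if "prefix Q R'" for Q
    using pre[of "D # Q"] that r rD k by auto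
  have tot: "int (k - 1) + snd (endpoint R') = 0"
    using assms P r rD k by (simp add: UH_free_schroeder_iff ht)
  obtain X Xs where X: "R' = X @ concat (map ((#) D) Xs)" "length Xs = k - 1"
    "\<forall>Y \<in> insert X (set Xs). snd (endpoint Y) = 0 \<and>
       (\<forall>Q. prefix Q Y \<longrightarrow> snd (endpoint Q) \<ge> 0)"
    using descent_decomposition[of R' "k - 1"] pre' tot by blast
  let ?Ps = "X # Xs"
  have eq: "P = replicate k U @ concat (map ((#) D) ?Ps)" using P r rD X by simp
  have "sublist Y P" if "Y \<in> set ?Ps" for Y
  proof -
    obtain A B where "?Ps = A @ Y # B" using \<open>Y \<in> set ?Ps\<close> by (meson split_list)
    then have "P = (replicate k U @ concat (map ((#) D) A) @ [D]) @ Y @ concat (map ((#) D) B)"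
      using eq by simp
    then show ?thesis by blast
  qed
  moreover have "UH_free P" using assms by (simp add: UH_free_schroeder_iff)
  ultimately have "UH_free Y" if "Y \<in> set ?Ps" for Y
    using that UH_free_sublist by blast
  then have ps: "\<forall>Y \<in> set ?Ps. UH_free_schroeder Y"
    using X(3) by (simp add: UH_free_schroeder_iff)
  show ?thesis
  proof (cases "k = 1")
    case True
    then show ?thesis using UD[of X] eq X ps by simp
  next
    case False
    then show ?thesis using UU[OF eq _ _ ps] X k by simp
  qed
qed

lemma first_factor_unique:
  assumes "UH_free_schroeder P" "UH_free_schroeder P'"
    and "P @ concat (map ((#) D) Ps) = P' @ concat (map ((#) D) Ps')"
  shows "P = P'"
proof -
  have aux: "u = []" if X: "UH_free_schroeder X" "UH_free_schroeder (X @ u)"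
    and eq: "u @ r = concat (map ((#) D) Qs)" for X u r :: path and Qs
  proof (rule ccontr)
    assume "u \<noteq> []"
    then obtain u' where "u = D # u'" using eq by (cases u; cases Qs) auto
    then have "prefix (X @ [D]) (X @ u)" by auto
    then have "snd (endpoint (X @ [D])) \<ge> 0" using X(2) by (metis UH_free_schroeder_iff)
    then show False using X(1) by (simp add: UH_free_schroeder_iff)
  qed
  from assms(3) obtain u where
    "P = P' @ u \<and> u @ concat (map ((#) D) Ps) = concat (map ((#) D) Ps') \<or>
     P @ u = P' \<and> concat (map ((#) D) Ps) = u @ concat (map ((#) D) Ps')"
    by (auto simp: append_eq_append_conv2)
  then show ?thesis
  proof
    assume "P = P' @ u \<and> u @ concat (map ((#) D) Ps) = concat (map ((#) D) Ps')"
    then show ?thesis using aux[of P' u "concat (map ((#) D) Ps)" Ps'] assms(1,2) by auto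
  next
    assume "P @ u = P' \<and> concat (map ((#) D) Ps) = u @ concat (map ((#) D) Ps')"
    then show ?thesis using aux[of P u "concat (map ((#) D) Ps')" Ps] assms(1,2) by auto
  qed
qed

lemma descent_unique:
  assumes "\<forall>P \<in> set Ps. UH_free_schroeder P" "\<forall>P \<in> set Ps'. UH_free_schroeder P"
    and "concat (map ((#) D) Ps) = concat (map ((#) D) Ps')"
  shows "Ps = Ps'"
  using assms
proof (induction Ps arbitrary: Ps')
  case Nil
  then show ?case by (cases Ps') auto
next
  case (Cons P Ps)
  then obtain P' Ps2 where Ps': "Ps' = P' # Ps2" by (cases Ps') auto
  have eq: "P @ concat (map ((#) D) Ps) = P' @ concat (map ((#) D) Ps2)"
    using Cons.prems(3) unfolding Ps' by simp
  have "UH_free_schroeder P" "UH_free_schroeder P'" using Cons.prems(1,2) Ps' by simp_all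
  from first_factor_unique[OF this eq] have P: "P = P'" .
  have "Ps = Ps2"
  proof (rule Cons.IH)
    show "concat (map ((#) D) Ps) = concat (map ((#) D) Ps2)"
      using eq unfolding P by simp
  qed (use Cons.prems(1,2) Ps' in simp_all)
  then show ?case using P Ps' by simp
qed

lemma factorization_unique:
  assumes "replicate k U @ concat (map ((#) D) Ps) = replicate k' U @ concat (map ((#) D) Ps')"
    and "Ps \<noteq> []" "Ps' \<noteq> []"
    and "\<forall>P \<in> set Ps. UH_free_schroeder P" "\<forall>P \<in> set Ps'. UH_free_schroeder P"
  shows "k = k' \<and> Ps = Ps'"
proof -
  have tw: "takeWhile ((=) U) (replicate j U @ concat (map ((#) D) Qs)) = replicate j U"
    if "Qs \<noteq> []" for j Qs
    using that by (induction j) (cases Qs; auto)+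
  have "replicate k U = replicate k' U"
    using tw[OF assms(2), of k] tw[OF assms(3), of k'] assms(1) by simp
  then have "k = k'" by (metis length_replicate)
  then show ?thesis using assms descent_unique by auto
qed

lemma UH_free_append:
  "UH_free A \<Longrightarrow> UH_free B \<Longrightarrow> B = [] \<or> hd B = D \<Longrightarrow> UH_free (A @ B)"
  unfolding UH_free_def
  by (cases B) (auto simp: sublist_append Cons_eq_append_conv)

lemma UH_free_Cons_D_iff: "UH_free (D # B) \<longleftrightarrow> UH_free B"
  by (auto simp: UH_free_def sublist_Cons_right)

lemma UH_free_replicate: "UH_free (replicate k U)"
proof -
  have "H \<notin> set (replicate k U)" by simp
  then show ?thesis unfolding UH_free_def using set_mono_sublist by fastforce
qed

lemma UH_free_descent:
  "\<forall>P \<in> set Ps. UH_free P \<Longrightarrow> UH_free (concat (map ((#) D) Ps))"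
proof (induction Ps)
  case Nil
  then show ?case by (simp add: UH_free_def)
next
  case (Cons P Ps)
  have "UH_free (P @ concat (map ((#) D) Ps))"
    by (rule UH_free_append) (use Cons in \<open>cases Ps; auto\<close>)+
  then show ?case by (simp add: UH_free_Cons_D_iff)
qed

lemma endpoint_descent:
  "\<forall>P \<in> set Ps. UH_free_schroeder P \<Longrightarrow>
     snd (endpoint (concat (map ((#) D) Ps))) = - int (length Ps)"
  by (induction Ps) (auto simp: UH_free_schroeder_iff)

lemma endpoint_prefix_descent:
  assumes "\<forall>P \<in> set Ps. UH_free_schroeder P" "prefix Q (concat (map ((#) D) Ps))"
  shows "snd (endpoint Q) \<ge> - int (length Ps)"
  using assms
proof (induction Ps arbitrary: Q)
  case (Cons P Ps)
  have P: "UH_free_schroeder P" and Ps: "\<forall>P \<in> set Ps. UH_free_schroeder P"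
    using Cons.prems by auto
  show ?case
  proof (cases Q)
    case Q: (Cons q Q')
    then have q: "q = D" "prefix Q' (P @ concat (map ((#) D) Ps))" using Cons.prems by auto
    from q(2) consider "prefix Q' P"
      | Z where "Q' = P @ Z" "prefix Z (concat (map ((#) D) Ps))"
      by (auto simp: prefix_append)
    then show ?thesis
    proof cases
      case 1
      then have "snd (endpoint Q') \<ge> 0" using P by (auto simp: UH_free_schroeder_iff)
      then show ?thesis using Q q by simp
    next
      case 2
      then have "snd (endpoint Z) \<ge> - int (length Ps)" using Cons.IH Ps by blast
      then show ?thesis using Q q 2 P by (simp add: UH_free_schroeder_iff)
    qed
  qed simp
qed simp

lemma endpoint_replicate_U: "endpoint (replicate k U) = (int k, int k)"
  by (induction k) (auto simp: zero_prod_def)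

lemma UH_free_schroeder_UU:
  assumes Ps: "\<forall>P \<in> set Ps. UH_free_schroeder P" and k: "length Ps = k"
  shows "UH_free_schroeder (replicate k U @ concat (map ((#) D) Ps))"
  unfolding UH_free_schroeder_iff
proof (intro conjI allI impI)
  show "UH_free (replicate k U @ concat (map ((#) D) Ps))"
    by (intro UH_free_append UH_free_replicate UH_free_descent)
      (use Ps in \<open>cases Ps; auto simp: UH_free_schroeder_iff\<close>)+
  show "snd (endpoint (replicate k U @ concat (map ((#) D) Ps))) = 0"
    using endpoint_descent[OF Ps] k by (simp add: endpoint_replicate_U)
next
  fix Q
  assume "prefix Q (replicate k U @ concat (map ((#) D) Ps))"
  then consider "prefix Q (replicate k U)"
    | Z where "Q = replicate k U @ Z" "prefix Z (concat (map ((#) D) Ps))"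
    by (auto simp: prefix_append)
  then show "snd (endpoint Q) \<ge> 0"
  proof cases
    case 1
    then have "set Q \<subseteq> {U}" using set_mono_prefix by fastforce
    then have "Q = replicate (length Q) U" by (metis replicate_eqI singletonD subsetD)
    then show ?thesis by (metis endpoint_replicate_U snd_conv of_nat_0_le_iff)
  next
    case 2
    then show ?thesis using endpoint_prefix_descent[OF Ps] k by (fastforce simp: endpoint_replicate_U)
  qed
qed

lemma UH_free_schroeder_UD: "UH_free_schroeder P \<Longrightarrow> UH_free_schroeder (U # D # P)"
  using UH_free_schroeder_UU[of "[P]" 1] by simp

lemma UH_free_schroeder_H: "UH_free_schroeder P \<Longrightarrow> UH_free_schroeder (H # P)"
  by (auto simp: UH_free_schroeder_iff UH_free_def sublist_Cons_right prefix_Cons)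

lemma two_le_iff: "2 \<le> (k :: nat) \<longleftrightarrow> (\<exists>j. k = Suc (Suc j))"
  by presburger

lemma length_factor:
  "P \<in> set Ps \<Longrightarrow> length P < length (concat (map ((#) D) Ps))"
  by (induction Ps) auto

subsection \<open>The bijection\<close>

text \<open>In the fourth equation \<open>Ps = [P\<^sub>1, \<dots>, P\<^sub>k]\<close>. The last equation covers
  the lists outside the domain of the map.\<close>

function psi :: "path \<Rightarrow> path" where
  "psi [] = []"
| "UH_free_schroeder P \<Longrightarrow> psi (H # P) = H # psi P"
| "UH_free_schroeder P \<Longrightarrow> psi (U # D # P) = U # D # psi P"
| "length Ps \<ge> 2 \<Longrightarrow> \<forall>P \<in> set Ps. UH_free_schroeder P \<Longrightarrow>
     psi (replicate (length Ps) U @ concat (map (\<lambda>P. D # P) Ps)) =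
       [U] @ concat (map (\<lambda>P. if P = [] then [H] else [U] @ psi P @ [D]) (butlast Ps))
           @ [D] @ psi (last Ps)"
| "\<not> UH_free_schroeder P \<Longrightarrow> psi P = undefined"
proof (goal_cases)
  case (1 P x)
  show ?case
  proof (cases "UH_free_schroeder x")
    case True
    then show ?thesis
      by (cases rule: UH_free_schroeder_cases) (use 1 in blast)+
  qed (use 1 in blast)
next
  case (14 Ps Ps')
  then have "Ps \<noteq> []" "Ps' \<noteq> []" by auto
  then have "Ps = Ps'" using factorization_unique 14 by blast
  then show ?case by simp
next
  case (15 Ps P)
  then show ?case using UH_free_schroeder_UU[OF 15(2) refl] by simp
next
  case (5 Ps)
  then show ?case by simp
next
  case (9 P Ps)
  then show ?case by (simp add: two_le_iff) auto
next
  case (12 P Ps)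
  then show ?case by (simp add: two_le_iff) auto
next
  case (10 P Q)
  then show ?case using UH_free_schroeder_H[of P] by simp
next
  case (13 P Q)
  then show ?case using UH_free_schroeder_UD[of P] by simp
qed simp_all
termination
proof (relation "measure length", goal_cases)
  case (4 Ps P)
  then show ?case using length_factor[of P Ps] in_set_butlastD[of P Ps] by simp
next
  case (5 Ps)
  then have "last Ps \<in> set Ps" by (intro last_in_set) auto
  then show ?case using length_factor[of "last Ps" Ps] by simp
qed simp_all

end

theory Submission
  imports Defs
begin

text \<open>Cases (2) and (3) of the map are one case: a UH-free path starting with \<open>U\<close> is
  \<open>U\<^sup>m\<^sup>+\<^sup>1 D Q\<^sub>1 \<dots> D Q\<^sub>m D R\<close> with \<open>m \<ge> 0\<close>, and its image is
  \<open>U g(\<psi> Q\<^sub>1) \<dots> g(\<psi> Q\<^sub>m) D \<psi>(R)\<close>, where \<open>g\<close> sends the empty path to \<open>H\<close> and any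
  other path \<open>Q\<close> to \<open>U Q D\<close>. On the other side, a nonempty path without peaks at even level
  starts with \<open>H\<close> or has the form \<open>U A D B\<close>, where \<open>A\<close> has no peaks at odd level. Such an
  \<open>A\<close> is a unique concatenation of paths \<open>g(C)\<close> with \<open>C\<close> having no peaks at even level: a
  component \<open>U C D\<close> of \<open>A\<close> has \<open>C\<close> nonempty since it is not a peak at level 1. Both families
  thus obey the same recursion, and the map respects it.\<close>

subsection \<open>Schroeder paths of arbitrary semilength\<close>

text \<open>Dropping the semilength lets inductions pass to subpaths of any length. The semilength
  is recovered as half of the first coordinate of the endpoint.\<close>

definition schroeder :: "path \<Rightarrow> bool" where
  "schroeder P \<longleftrightarrow> snd (endpoint P) = 0 \<and> (\<forall>Q. prefix Q P \<longrightarrow> snd (endpoint Q) \<ge> 0)"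

lemma schroeder_path_iff:
  "schroeder_path n P \<longleftrightarrow> schroeder P \<and> fst (endpoint P) = 2 * int n"
  by (auto simp: schroeder_path_def schroeder_def prod_eq_iff)

lemma SH_iff: "P \<in> SH n \<longleftrightarrow> UH_free_schroeder P \<and> fst (endpoint P) = 2 * int n"
  by (auto simp: SH_def schroeder_path_iff UH_free_schroeder_iff schroeder_def)

lemma schroeder_Nil [simp]: "schroeder []"
  by (simp add: schroeder_def)

lemma schroeder_H [simp]: "schroeder (H # P) \<longleftrightarrow> schroeder P"
proof -
  have "prefix (H # Q) (H # P) \<longleftrightarrow> prefix Q P" for Q by simp
  then show ?thesis unfolding schroeder_def by (force simp: prefix_Cons)
qed

lemma schroeder_append:
  assumes "schroeder P" "schroeder Q"
  shows "schroeder (P @ Q)"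
  using assms by (auto simp: schroeder_def prefix_append)

lemma schroeder_elevate:
  assumes "schroeder P"
  shows "schroeder (U # P @ [D])"
proof -
  have "snd (endpoint Q) \<ge> 0" if "prefix Q (U # P @ [D])" for Q
  proof (cases Q)
    case (Cons q Q')
    then have "q = U" "prefix Q' P \<or> Q' = P @ [D]"
      using that by (auto simp: prefix_append prefix_Cons)
    then show ?thesis using Cons assms by (auto simp: schroeder_def)
  qed simp
  then show ?thesis using assms by (simp add: schroeder_def)
qed

lemma schroeder_arch:
  assumes "schroeder A" "schroeder B"
  shows "schroeder (U # A @ D # B)"
  using schroeder_append[OF schroeder_elevate[OF assms(1)] assms(2)] by simp

text \<open>First-return decomposition. After an initial \<open>U\<close> the rest stays at or above
  -1 relative to its start and ends at -1, so \<open>descent_decomposition\<close> with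
  \<open>m = 1\<close> splits it at a single \<open>D\<close>.\<close>

lemma schroeder_cases:
  assumes "schroeder P"
  obtains (Nil) "P = []"
  | (H) P' where "P = H # P'" "schroeder P'"
  | (arch) A B where "P = U # A @ D # B" "schroeder A" "schroeder B"
proof (cases P)
  case (Cons s R)
  show ?thesis
  proof (cases s)
    case U
    have "int 1 + snd (endpoint Q) \<ge> 0" if "prefix Q R" for Q
    proof -
      have "prefix (U # Q) P" using that Cons U by simp
      then have "snd (endpoint (U # Q)) \<ge> 0" using assms unfolding schroeder_def by blast
      then show ?thesis by simp
    qed
    moreover have "int 1 + snd (endpoint R) = 0"
      using assms Cons U by (simp add: schroeder_def)
    ultimately obtain A Bs where *: "R = A @ concat (map ((#) D) Bs)" "length Bs = 1"
      "\<forall>X \<in> insert A (set Bs). schroeder X"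
      using descent_decomposition[of R 1] unfolding schroeder_def by blast
    then obtain B where "Bs = [B]" by (auto simp: length_Suc_conv)
    then show ?thesis using arch[of A B] * Cons U by simp
  next
    case D
    then have "prefix [D] P" using Cons by simp
    then have "snd (endpoint [D]) \<ge> 0" using assms unfolding schroeder_def by blast
    then show ?thesis by simp
  next
    case H
    then show ?thesis using that(2) assms Cons by simp
  qed
qed (rule Nil)

lemma schroeder_not_ends_U: "schroeder P \<Longrightarrow> P = Q @ [U] \<Longrightarrow> False"
  unfolding schroeder_def by (auto dest!: spec[of _ Q])

text \<open>If one of \<open>A\<close>, \<open>A'\<close> properly extended the other, the surplus
  would begin with \<open>D\<close> and take the longer path to height -1.\<close>

lemma schroeder_before_D_unique:
  assumes "schroeder A" "schroeder A'" "A @ D # B = A' @ D # B'"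
  shows "A = A' \<and> B = B'"
proof -
  have aux: "u = []" if X: "schroeder X" "schroeder (X @ u)" and eq: "u @ r = D # s"
    for X u r s
  proof (rule ccontr)
    assume "u \<noteq> []"
    then obtain u' where "u = D # u'" using eq by (cases u) auto
    then have "prefix (X @ [D]) (X @ u)" by auto
    then have "snd (endpoint (X @ [D])) \<ge> 0" using X(2) unfolding schroeder_def by blast
    then show False using X(1) by (simp add: schroeder_def)
  qed
  from assms(3) obtain u where
    "A = A' @ u \<and> u @ D # B = D # B' \<or> A @ u = A' \<and> D # B = u @ D # B'"
    by (auto simp: append_eq_append_conv2)
  then show ?thesis
  proof
    assume "A = A' @ u \<and> u @ D # B = D # B'"
    then show ?thesis using aux[of A' u "D # B" "B'"] assms by auto
  next
    assume "A @ u = A' \<and> D # B = u @ D # B'"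
    then show ?thesis using aux[of A u "D # B'" B] assms by auto
  qed
qed

subsection \<open>Peaks\<close>

lemma peak_level_Nil [simp]: "\<not> peak_level [] l"
  by (simp add: peak_level_def)

lemma peak_level_Cons:
  "peak_level (s # P) l \<longleftrightarrow>
     s = U \<and> l = 1 \<and> (\<exists>P'. P = D # P') \<or> peak_level P (l - snd (step_vector s))"
proof
  assume "peak_level (s # P) l"
  then obtain A B where *: "s # P = A @ [U, D] @ B" "l = snd (endpoint (A @ [U]))"
    unfolding peak_level_def by blast
  show "s = U \<and> l = 1 \<and> (\<exists>P'. P = D # P') \<or> peak_level P (l - snd (step_vector s))"
  proof (cases A)
    case Nil
    then show ?thesis using * by simp
  next
    case (Cons a A')
    then have "P = A' @ [U, D] @ B" "l - snd (step_vector s) = snd (endpoint (A' @ [U]))"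
      using * by simp_all
    then show ?thesis unfolding peak_level_def by blast
  qed
next
  assume "s = U \<and> l = 1 \<and> (\<exists>P'. P = D # P') \<or> peak_level P (l - snd (step_vector s))"
  then show "peak_level (s # P) l"
  proof
    assume "s = U \<and> l = 1 \<and> (\<exists>P'. P = D # P')"
    then show ?thesis unfolding peak_level_def by (intro exI[of _ "[]"] exI[of _ "tl P"]) auto
  next
    assume "peak_level P (l - snd (step_vector s))"
    then obtain A B where "P = A @ [U, D] @ B"
      "l - snd (step_vector s) = snd (endpoint (A @ [U]))"
      unfolding peak_level_def by blast
    then show ?thesis unfolding peak_level_def
      by (intro exI[of _ "s # A"] exI[of _ B]) auto
  qed
qed

text \<open>The hypothesis excludes a peak straddling the cut, the only kind that neither factor
  sees.\<close>

lemma peak_level_append: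
  assumes "A = [] \<or> last A \<noteq> U"
  shows "peak_level (A @ B) l \<longleftrightarrow> peak_level A l \<or> peak_level B (l - snd (endpoint A))"
  using assms
proof (induction A arbitrary: l)
  case (Cons s A)
  then show ?case
    by (cases "A = []") (auto simp: peak_level_Cons Cons_eq_append_conv append_eq_Cons_conv algebra_simps)
qed simp

lemma schroeder_last: "schroeder A \<Longrightarrow> A = [] \<or> last A \<noteq> U"
  using schroeder_not_ends_U by (metis append_butlast_last_id)

lemma peak_level_schroeder_append:
  "schroeder A \<Longrightarrow> peak_level (A @ B) l \<longleftrightarrow> peak_level A l \<or> peak_level B l"
  using peak_level_append[OF schroeder_last, of A B l] by (simp add: schroeder_def)

lemma peak_level_H [simp]: "peak_level (H # P) l \<longleftrightarrow> peak_level P l"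
  by (simp add: peak_level_Cons)

lemma peak_level_arch:
  assumes "schroeder A"
  shows "peak_level (U # A @ D # B) l \<longleftrightarrow>
    A = [] \<and> l = 1 \<or> peak_level A (l - 1) \<or> peak_level B l"
proof -
  \<comment> \<open>A nonempty Schroeder path never starts with \<open>D\<close>, so the leading
    \<open>U\<close> belongs to a peak only over an empty \<open>A\<close>.\<close>
  have "(\<exists>P'. A @ D # B = D # P') \<longleftrightarrow> A = []"
    using assms by (cases rule: schroeder_cases) auto
  then show ?thesis
    using peak_level_schroeder_append[OF assms, of "D # B" "l - 1"]
    by (auto simp: peak_level_Cons)
qed

section \<open>Parity of peak levels\<close>

definition odd_peaks :: "path \<Rightarrow> bool" where
  "odd_peaks P \<longleftrightarrow> schroeder P \<and> (\<forall>l. peak_level P l \<longrightarrow> odd l)"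

text \<open>The condition on the interior of an arch in a path with \<open>odd_peaks\<close>:
  elevation by one step flips the parity of every peak level.\<close>

definition even_peaks :: "path \<Rightarrow> bool" where
  "even_peaks P \<longleftrightarrow> schroeder P \<and> (\<forall>l. peak_level P l \<longrightarrow> even l)"

lemma SE_iff: "P \<in> SE n \<longleftrightarrow> odd_peaks P \<and> fst (endpoint P) = 2 * int n"
  by (auto simp: SE_def schroeder_path_iff odd_peaks_def)

lemma odd_peaks_Nil [simp]: "odd_peaks []"
  by (simp add: odd_peaks_def)

lemma even_peaks_Nil [simp]: "even_peaks []"
  by (simp add: even_peaks_def)

lemma odd_peaks_H [simp]: "odd_peaks (H # P) \<longleftrightarrow> odd_peaks P"
  by (simp add: odd_peaks_def)

lemma even_peaks_H [simp]: "even_peaks (H # P) \<longleftrightarrow> even_peaks P"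
  by (simp add: even_peaks_def)

lemma odd_peaks_arch:
  assumes "schroeder A" "schroeder B"
  shows "odd_peaks (U # A @ D # B) \<longleftrightarrow> even_peaks A \<and> odd_peaks B"
proof -
  have "(\<forall>l. peak_level A (l - 1) \<longrightarrow> odd l) \<longleftrightarrow> (\<forall>l. peak_level A l \<longrightarrow> even l)"
    by (metis add_diff_cancel_right' diff_add_cancel odd_one odd_add)
  then show ?thesis
    using assms schroeder_arch[OF assms]
    unfolding odd_peaks_def even_peaks_def peak_level_arch[OF assms(1)] by auto
qed

text \<open>Unlike in \<open>odd_peaks_arch\<close>, an empty \<open>A\<close> is excluded, because
  \<open>UD\<close> on the axis is a peak at the odd level 1.\<close>

lemma even_peaks_arch:
  assumes "schroeder A" "schroeder B"
  shows "even_peaks (U # A @ D # B) \<longleftrightarrow> A \<noteq> [] \<and> odd_peaks A \<and> even_peaks B"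
proof -
  have "(\<forall>l. peak_level A (l - 1) \<longrightarrow> even l) \<longleftrightarrow> (\<forall>l. peak_level A l \<longrightarrow> odd l)"
    by (metis add_diff_cancel_right' diff_add_cancel odd_one odd_add)
  then show ?thesis
    using assms schroeder_arch[OF assms]
    unfolding odd_peaks_def even_peaks_def peak_level_arch[OF assms(1)] by auto
qed

subsection \<open>Concatenations of components\<close>

text \<open>\<open>H\<close> replaces \<open>UD\<close>, the forbidden arch over the empty path.
  Both have width 2, so the width does not depend on which case applies.\<close>

definition component :: "path \<Rightarrow> path" where
  "component Q = (if Q = [] then [H] else U # Q @ [D])"

lemma component_Nil [simp]: "component [] = [H]"
  by (simp add: component_def)

lemma component_nonempty [simp]: "Q \<noteq> [] \<Longrightarrow> component Q = U # Q @ [D]"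
  by (simp add: component_def)

lemma component_not_Nil [simp]: "component Q \<noteq> []"
  by (simp add: component_def)

lemma fst_endpoint_component [simp]: "fst (endpoint (component Q)) = fst (endpoint Q) + 2"
  by (simp add: component_def)

lemma schroeder_component: "schroeder Q \<Longrightarrow> schroeder (component Q)"
  by (simp add: component_def schroeder_elevate)

lemma schroeder_components:
  "\<forall>Q \<in> set Qs. schroeder Q \<Longrightarrow> schroeder (concat (map component Qs))"
  by (induction Qs) (auto intro: schroeder_append schroeder_component)

lemma even_peaks_components:
  "\<forall>Q \<in> set Qs. odd_peaks Q \<Longrightarrow> even_peaks (concat (map component Qs))"
proof (induction Qs)
  case (Cons Q Qs)
  then have "even_peaks (concat (map component Qs))" "odd_peaks Q" by simp_all
  then show ?case
    using even_peaks_arch[of Q "concat (map component Qs)"]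
    by (cases "Q = []") (simp_all add: odd_peaks_def even_peaks_def)
qed simp

lemma even_peaks_decompose:
  assumes "even_peaks A"
  obtains Qs where "A = concat (map component Qs)" "\<forall>Q \<in> set Qs. odd_peaks Q"
proof -
  have "\<exists>Qs. A = concat (map component Qs) \<and> (\<forall>Q \<in> set Qs. odd_peaks Q)"
    using assms
  proof (induction "length A" arbitrary: A rule: less_induct)
    case less
    then have "schroeder A" by (simp add: even_peaks_def)
    then show ?case
    proof (cases rule: schroeder_cases)
      case Nil
      then show ?thesis by (intro exI[of _ "[]"]) simp
    next
      case (H A')
      then obtain Qs where "A' = concat (map component Qs)" "\<forall>Q \<in> set Qs. odd_peaks Q"
        using less by force
      then show ?thesis using H by (intro exI[of _ "[] # Qs"]) simp
    next
      case (arch C B)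
      then have *: "C \<noteq> []" "odd_peaks C" "even_peaks B"
        using less.prems even_peaks_arch by auto
      then obtain Qs where "B = concat (map component Qs)" "\<forall>Q \<in> set Qs. odd_peaks Q"
        using less.hyps[of B] arch by auto
      then show ?thesis using arch * by (intro exI[of _ "C # Qs"]) simp
    qed
  qed
  then show ?thesis using that by blast
qed

text \<open>The first step, \<open>H\<close> or \<open>U\<close>, tells whether the first component
  comes from the empty path; if not, \<open>schroeder_before_D_unique\<close> locates its closing
  \<open>D\<close>.\<close>

lemma components_unique:
  assumes "\<forall>Q \<in> set Qs. schroeder Q" "\<forall>Q \<in> set Qs'. schroeder Q"
    and "concat (map component Qs) = concat (map component Qs')"
  shows "Qs = Qs'"
  using assms
proof (induction Qs arbitrary: Qs')
  case Nil
  then show ?case by (cases Qs') simp_all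
next
  case (Cons Q Qs)
  obtain Q' Qs2 where Qs': "Qs' = Q' # Qs2"
    using Cons.prems(3) by (cases Qs') simp_all
  have "Q = Q' \<and> concat (map component Qs) = concat (map component Qs2)"
  proof (cases "Q = [] \<or> Q' = []")
    case True
    then have "Q = [] \<and> Q' = []"
      using Cons.prems(3) Qs' by (auto simp: component_def split: if_splits)
    then show ?thesis using Cons.prems(3) Qs' by simp
  next
    case False
    then have "Q @ D # concat (map component Qs) = Q' @ D # concat (map component Qs2)"
      using Cons.prems(3) Qs' by simp
    then show ?thesis
      by (rule schroeder_before_D_unique[rotated 2]) (use Cons.prems(1,2) Qs' in simp_all)
  qed
  moreover have "Qs = Qs2" if "concat (map component Qs) = concat (map component Qs2)"
    by (rule Cons.IH[OF _ _ that]) (use Cons.prems Qs' in simp_all)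
  ultimately show ?case using Qs' by simp
qed

subsection \<open>The recursion satisfied by the map\<close>

text \<open>The last factor \<open>R\<close> is kept apart from the list because \<open>psi\<close>
  places its image outside the arch. For \<open>Qs = []\<close> this is
  \<open>U # D # R\<close>.\<close>

definition ascent_path :: "path list \<Rightarrow> path \<Rightarrow> path" where
  "ascent_path Qs R = replicate (Suc (length Qs)) U @ concat (map ((#) D) Qs) @ D # R"

lemma UH_free_schroeder_ascent_path:
  assumes "\<forall>Q \<in> set Qs. UH_free_schroeder Q" "UH_free_schroeder R"
  shows "UH_free_schroeder (ascent_path Qs R)"
  using UH_free_schroeder_UU[of "Qs @ [R]"] assms by (auto simp: ascent_path_def)

lemma UH_free_schroeder_induct [consumes 1, case_names Nil H ascent]:
  assumes "UH_free_schroeder P"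
    and "Prop []"
    and "\<And>P. UH_free_schroeder P \<Longrightarrow> Prop P \<Longrightarrow> Prop (H # P)"
    and asc: "\<And>Qs R. (\<And>Q. Q \<in> set Qs \<Longrightarrow> UH_free_schroeder Q) \<Longrightarrow> UH_free_schroeder R \<Longrightarrow>
      (\<And>Q. Q \<in> set Qs \<Longrightarrow> Prop Q) \<Longrightarrow> Prop R \<Longrightarrow> Prop (ascent_path Qs R)"
  shows "Prop P"
  using assms(1)
proof (induction "length P" arbitrary: P rule: less_induct)
  case less
  from less.prems show ?case
  proof (cases rule: UH_free_schroeder_cases)
    case Nil
    then show ?thesis using assms(2) by simp
  next
    case (H P')
    then show ?thesis using assms(3)[of P'] less.hyps[of P'] by simp
  next
    case (UD P')
    then have "Prop (ascent_path [] P')" using asc[of "[]" P'] less.hyps[of P'] by simp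
    then show ?thesis using UD by (simp add: ascent_path_def)
  next
    case (UU k Ps)
    then have "Ps \<noteq> []" by auto
    then obtain Qs R where Ps: "Ps = Qs @ [R]" by (metis rev_exhaust)
    have P: "P = ascent_path Qs R"
      unfolding ascent_path_def UU(1) UU(3)[symmetric] Ps by simp
    have "Prop Q" if "Q \<in> set Ps" for Q
    proof (rule less.hyps)
      show "length Q < length P" unfolding UU(1) using length_factor[OF that] by simp
    qed (use that UU in blast)
    then show ?thesis unfolding P using UU Ps by (intro asc) auto
  qed
qed

lemma UH_free_schroeder_ascent_cases:
  assumes "UH_free_schroeder P"
  obtains (Nil) "P = []"
  | (H) P' where "P = H # P'" "UH_free_schroeder P'"
  | (ascent) Qs R where "P = ascent_path Qs R" "\<And>Q. Q \<in> set Qs \<Longrightarrow> UH_free_schroeder Q"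
      "UH_free_schroeder R"
proof -
  from assms have "P = [] \<or> (\<exists>P'. P = H # P' \<and> UH_free_schroeder P') \<or>
      (\<exists>Qs R. P = ascent_path Qs R \<and> (\<forall>Q \<in> set Qs. UH_free_schroeder Q) \<and> UH_free_schroeder R)"
    by (induction P rule: UH_free_schroeder_induct) blast+
  then show ?thesis using that by blast
qed

text \<open>Reconciles two tests for emptiness: \<open>psi\<close> inspects the factor itself,
  \<open>component\<close> its image.\<close>

lemma psi_eq_Nil_iff:
  assumes "UH_free_schroeder P"
  shows "psi P = [] \<longleftrightarrow> P = []"
  using assms
proof (cases rule: UH_free_schroeder_cases)
  case (UU k Ps)
  then show ?thesis using psi.simps(4)[of Ps] by auto
qed simp_all

lemma psi_ascent_path:
  assumes Qs: "\<And>Q. Q \<in> set Qs \<Longrightarrow> UH_free_schroeder Q" and R: "UH_free_schroeder R"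
  shows "psi (ascent_path Qs R) = U # concat (map component (map psi Qs)) @ D # psi R"
proof (cases "Qs = []")
  case True
  then show ?thesis using R by (simp add: ascent_path_def)
next
  case False
  have "map (\<lambda>P. if P = [] then [H] else [U] @ psi P @ [D]) Qs = map (component \<circ> psi) Qs"
    using Qs psi_eq_Nil_iff by (intro map_cong) (auto simp: component_def)
  moreover have "2 \<le> length (Qs @ [R])" using False by (cases Qs) auto
  moreover have "\<forall>P \<in> set (Qs @ [R]). UH_free_schroeder P" using Qs R by auto
  ultimately show ?thesis
    using psi.simps(4)[of "Qs @ [R]"] by (simp add: ascent_path_def del: map_eq_conv)
qed

section \<open>Peaks and semilength of the image\<close>

lemma odd_peaks_psi:
  assumes "UH_free_schroeder P"
  shows "odd_peaks (psi P)"
  using assms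
proof (induction P rule: UH_free_schroeder_induct)
  case (ascent Qs R)
  then have *: "\<forall>Q \<in> set (map psi Qs). odd_peaks Q" by simp
  then have "\<forall>Q \<in> set (map psi Qs). schroeder Q" by (simp add: odd_peaks_def)
  moreover have "schroeder (psi R)" using ascent by (simp add: odd_peaks_def)
  \<comment> \<open>The components only have peaks at even levels, and the enclosing
    \<open>U\<close> makes these levels odd.\<close>
  ultimately have "odd_peaks (U # concat (map component (map psi Qs)) @ D # psi R)"
    using odd_peaks_arch[OF schroeder_components] even_peaks_components[OF *] ascent by blast
  then show ?case using psi_ascent_path[of Qs R] ascent by simp
qed simp_all

lemma schroeder_psi: "UH_free_schroeder P \<Longrightarrow> schroeder (psi P)"
  using odd_peaks_psi by (simp add: odd_peaks_def)

lemma fst_endpoint_psi: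
  assumes "UH_free_schroeder P"
  shows "fst (endpoint (psi P)) = fst (endpoint P)"
  using assms
proof (induction P rule: UH_free_schroeder_induct)
  case (ascent Qs R)
  \<comment> \<open>A component adds width 2 to its inner path and \<open>D # Q\<close> only 1; the
    difference \<open>length Qs\<close> is supplied by the initial run of \<open>U\<close> in
    \<open>ascent_path\<close>.\<close>
  have "fst (endpoint (concat (map component (map psi Qs)))) =
      fst (endpoint (concat (map ((#) D) Qs))) + int (length Qs)"
    using ascent.IH(1) by (induction Qs) simp_all
  then show ?case
    using psi_ascent_path[of Qs R] ascent
    by (simp add: ascent_path_def endpoint_replicate_U)
qed simp_all

section \<open>Injectivity and surjectivity\<close>

lemma psi_inj:
  assumes "UH_free_schroeder P" "UH_free_schroeder P'" "psi P = psi P'"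
  shows "P = P'"
  using assms
proof (induction P arbitrary: P' rule: UH_free_schroeder_induct)
  case Nil
  then show ?case using psi_eq_Nil_iff[of P'] by simp
next
  case (H P)
  have eq: "psi P' = H # psi P" using H.prems(2) H.hyps by simp
  from H.prems(1) show ?case
  proof (cases rule: UH_free_schroeder_ascent_cases)
    case Nil
    then show ?thesis using eq by simp
  next
    case P': (H P2)
    then show ?thesis using eq H.IH[of P2] by simp
  next
    case (ascent Qs R)
    then show ?thesis using eq psi_ascent_path[of Qs R] by simp
  qed
next
  case (ascent Qs R)
  have eq: "psi P' = U # concat (map component (map psi Qs)) @ D # psi R"
    using psi_ascent_path[of Qs R] ascent.hyps ascent.prems(2) by metis
  have sch: "\<forall>Q \<in> set (map psi Qs). schroeder Q" using ascent.hyps schroeder_psi by auto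
  from ascent.prems(1) show ?case
  proof (cases rule: UH_free_schroeder_ascent_cases)
    case Nil
    then show ?thesis using eq by simp
  next
    case (H P2)
    then show ?thesis using eq by simp
  next
    case P': (ascent Qs' R')
    have sch': "\<forall>Q \<in> set (map psi Qs'). schroeder Q" using P' schroeder_psi by auto
    \<comment> \<open>The first step of the image has settled the case. The first return to the axis
      now separates the components from \<open>psi R\<close>.\<close>
    have "concat (map component (map psi Qs)) @ D # psi R =
        concat (map component (map psi Qs')) @ D # psi R'"
      using eq psi_ascent_path[of Qs' R'] P' by (metis list.inject)
    then have *: "concat (map component (map psi Qs)) = concat (map component (map psi Qs'))"
        "psi R = psi R'"
      using schroeder_before_D_unique[OF schroeder_components[OF sch] schroeder_components[OF sch']]
      by blast+
    have "map psi Qs = map psi Qs'" by (rule components_unique[OF sch sch' *(1)])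
    \<comment> \<open>The pointwise form lets the induction hypothesis be applied to each member of
      \<open>Qs\<close>.\<close>
    then have "list_all2 (\<lambda>Q Q'. psi Q = psi Q') Qs Qs'"
      by (simp add: list_all2_map1 list_all2_map2 list_all2_eq flip: list.rel_eq)
    then have "list_all2 (=) Qs Qs'"
      by (rule list.rel_mono_strong) (use ascent.IH(1) P'(2) in blast)
    then have "Qs = Qs'" by (simp add: list.rel_eq)
    moreover have "R = R'" using ascent.IH(2) P'(3) *(2) by blast
    ultimately show ?thesis using P'(1) by simp
  qed
qed

lemma length_component_factor:
  "Q \<in> set Qs \<Longrightarrow> length Q < length (concat (map component Qs))"
  by (induction Qs) (auto simp: component_def)

lemma psi_surj:
  assumes "odd_peaks Q"
  shows "\<exists>P. UH_free_schroeder P \<and> psi P = Q"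
  using assms
proof (induction "length Q" arbitrary: Q rule: less_induct)
  case less
  then have "schroeder Q" by (simp add: odd_peaks_def)
  then show ?case
  proof (cases rule: schroeder_cases)
    case Nil
    then show ?thesis by (intro exI[of _ "[]"]) simp
  next
    case (H Q')
    then obtain P where "UH_free_schroeder P" "psi P = Q'" using less by force
    then show ?thesis using H UH_free_schroeder_H by (intro exI[of _ "H # P"]) simp
  next
    case (arch A B)
    then have "even_peaks A" "odd_peaks B" using less.prems odd_peaks_arch by auto
    obtain Qs where Qs: "A = concat (map component Qs)" "\<forall>Q \<in> set Qs. odd_peaks Q"
      using \<open>even_peaks A\<close> even_peaks_decompose by blast
    \<comment> \<open>The inverse is built by recursion: the inner paths of the components of
      \<open>A\<close>, and \<open>B\<close>, are shorter than \<open>Q\<close>, and their preimages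
      become the factors of an \<open>ascent_path\<close>.\<close>
    have "\<exists>P. UH_free_schroeder P \<and> psi P = X" if "X \<in> set Qs" for X
    proof (rule less.hyps)
      show "length X < length Q" using length_component_factor[OF that] Qs(1) arch by simp
    qed (use that Qs in blast)
    then obtain f where f: "\<And>X. X \<in> set Qs \<Longrightarrow> UH_free_schroeder (f X) \<and> psi (f X) = X"
      by metis
    obtain R where R: "UH_free_schroeder R" "psi R = B"
      using less.hyps[of B] \<open>odd_peaks B\<close> arch by auto
    have "map psi (map f Qs) = Qs" using f by (simp add: map_idI)
    then have "psi (ascent_path (map f Qs) R) = Q"
      using psi_ascent_path[of "map f Qs" R] f R Qs(1) arch by auto
    moreover have "UH_free_schroeder (ascent_path (map f Qs) R)"
      using UH_free_schroeder_ascent_path[of "map f Qs" R] f R by auto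
    ultimately show ?thesis by blast
  qed
qed

theorem theorem4:
  fixes n :: nat
  shows "bij_betw psi (SH n) (SE n)"
proof (rule bij_betw_imageI)
  show "inj_on psi (SH n)"
    by (rule inj_onI) (auto simp: SH_iff intro: psi_inj)
  show "psi ` SH n = SE n"
  proof
    show "psi ` SH n \<subseteq> SE n"
      by (auto simp: SH_iff SE_iff odd_peaks_psi fst_endpoint_psi)
    show "SE n \<subseteq> psi ` SH n"
    proof
      fix Q
      assume Q: "Q \<in> SE n"
      then obtain P where "UH_free_schroeder P" "psi P = Q"
        using psi_surj by (auto simp: SE_iff)
      \<comment> \<open>The preimage comes with no stated semilength; preservation of width forces
        it to be \<open>n\<close>.\<close>
      then show "Q \<in> psi ` SH n" using Q fst_endpoint_psi by (auto simp: SH_iff SE_iff)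
    qed
  qed
qed

end
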